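(* Let $I$ be an input with no duplicate elements and let $\mathrm{OPT}$ be the optimal number of runs on $I$ given an $M$-size buffer. Then there exists an online algorithm $A$ with an $M$-size buffer and $4M$-visibility whose output $S$ always satisfies $R(S)\le\tfrac32\,\mathrm{OPT}$.
   Context: Up-down run generation problem: an input stream $I$ of elements from a totally ordered set is presented in order to an algorithm with a buffer of $M$ slots; the algorithm reads elements in order into the buffer and writes elements from the buffer to an output sequence $S$, each write freeing a slot that is filled by the next input element. A run is a sorted or reverse-sorted sequence; $R(S)$ is the smallest $k$ such that $S$ is a concatenation of $k$ runs; $\mathrm{OPT}$ is the minimum of $R(S)$ over all outputs achievable by (offline) algorithms with buffer size $M$. The unwritten-element sequence is the buffer contents followed by the unread input. An online algorithm with $X$-visibility ($X\ge M$) knows, at each step, the next $X$ elements of its unwritten-element sequence and may use this knowledge in its decisions, but still uses only its $M$-size buffer for reading and writing and must read input elements sequentially. *)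

theory Defs
  imports Complex_Main
begin

definition is_run :: "'a::linorder list \<Rightarrow> bool" where
  "is_run r \<longleftrightarrow> sorted r \<or> sorted (rev r)"

definition num_runs :: "'a::linorder list \<Rightarrow> nat" where
  "num_runs S = (LEAST k. \<exists>rs. length rs = k \<and> concat rs = S \<and> (\<forall>r\<in>set rs. is_run r))"

text \<open>A configuration consists of the output written so far, the contents of the buffer
  (kept in order of arrival) and the unread input.\<close>

type_synonym 'a config = "'a list \<times> 'a list \<times> 'a list"

definition init_config :: "nat \<Rightarrow> 'a list \<Rightarrow> 'a config" where
  "init_config M I = ([], take M I, drop M I)"

text \<open>Ejecting \<open>x\<close> frees one slot, which is filled at once by the next input element, if any.\<close>

fun write_elem :: "'a \<Rightarrow> 'a config \<Rightarrow> 'a config" where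
  "write_elem x (S, B, U) = (S @ [x], remove1 x B @ take 1 U, drop 1 U)"

inductive step :: "'a config \<Rightarrow> 'a config \<Rightarrow> bool" where
  "x \<in> set B \<Longrightarrow> step (S, B, U) (write_elem x (S, B, U))"

definition achievable :: "nat \<Rightarrow> 'a list \<Rightarrow> 'a list \<Rightarrow> bool" where
  "achievable M I S \<longleftrightarrow> step\<^sup>*\<^sup>* (init_config M I) (S, [], [])"

definition OPT :: "nat \<Rightarrow> 'a::linorder list \<Rightarrow> nat" where
  "OPT M I = (LEAST k. \<exists>S. achievable M I S \<and> num_runs S = k)"

text \<open>An online algorithm is given by its decision function: from the output written so far and
  the visible part \<open>W\<close> of the unwritten-element sequence it determines the element to write next.
  These two arguments comprise all elements that the algorithm has seen up to now.\<close>

type_synonym 'a algorithm = "'a list \<Rightarrow> 'a list \<Rightarrow> 'a"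

text \<open>The buffer is always full unless the input is exhausted, so for visibility at least \<open>M\<close>
  its contents are exactly the first \<open>M\<close> visible elements (all of them, if there are fewer).
  Only these may be written.\<close>

definition uses_buffer :: "nat \<Rightarrow> 'a algorithm \<Rightarrow> bool" where
  "uses_buffer M A \<longleftrightarrow> (\<forall>S W. W \<noteq> [] \<longrightarrow> A S W \<in> set (take M W))"

definition online_algorithm :: "nat \<Rightarrow> nat \<Rightarrow> 'a algorithm \<Rightarrow> bool" where
  "online_algorithm M X A \<longleftrightarrow> M \<le> X \<and> uses_buffer M A"

fun online_step :: "nat \<Rightarrow> 'a algorithm \<Rightarrow> 'a config \<Rightarrow> 'a config" where
  "online_step X A (S, B, U) = write_elem (A S (take X (B @ U))) (S, B, U)"

text \<open>Each step writes one element, so the output is complete after \<open>length I\<close> steps.\<close>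

definition online_output :: "nat \<Rightarrow> nat \<Rightarrow> 'a algorithm \<Rightarrow> 'a list \<Rightarrow> 'a list" where
  "online_output M X A I = fst ((online_step X A ^^ length I) (init_config M I))"

lemma online_steps:
  assumes A: "online_algorithm M X A" and M: "M > 0" and n: "n \<le> length I"
  shows "\<exists>S B U. (online_step X A ^^ n) (init_config M I) = (S, B, U)
    \<and> step\<^sup>*\<^sup>* (init_config M I) (S, B, U)
    \<and> length B + length U = length I - n \<and> length B = min M (length I - n)"
  using n
proof (induction n)
  case 0
  then show ?case by (auto simp: init_config_def)
next
  case (Suc n)
  then obtain S B U where
    eq: "(online_step X A ^^ n) (init_config M I) = (S, B, U)" and
    st: "step\<^sup>*\<^sup>* (init_config M I) (S, B, U)" and
    len: "length B + length U = length I - n" "length B = min M (length I - n)"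
    by (auto simp: Suc_le_eq)
  define x where "x = A S (take X (B @ U))"
  have MX: "M \<le> X" using A by (simp add: online_algorithm_def)
  have ne: "take X (B @ U) \<noteq> []" using len M MX Suc.prems by auto
  have "take M (take X (B @ U)) = B"
    using len MX by (auto simp: min_def split: if_splits)
  then have x: "x \<in> set B"
    using A ne unfolding online_algorithm_def uses_buffer_def x_def by metis
  have "step (S, B, U) (write_elem x (S, B, U))" using x by (rule step.intros)
  then have st': "step\<^sup>*\<^sup>* (init_config M I) (write_elem x (S, B, U))" using st by simp
  have "length (remove1 x B) = length B - 1" "length B > 0"
    using x by (auto simp: length_remove1)
  moreover have "(online_step X A ^^ Suc n) (init_config M I) = write_elem x (S, B, U)"
    using eq by (simp add: x_def)
  ultimately show ?case
    using st' len Suc.prems by (simp add: min_def split: if_splits) linarith+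
qed

lemma achievable_online_output:
  assumes "online_algorithm M X A" "M > 0"
  shows "achievable M I (online_output M X A I)"
  using online_steps[OF assms order.refl, of I] by (auto simp: achievable_def online_output_def)

lemma OPT_attained:
  assumes "M > 0"
  shows "\<exists>S. achievable M I S \<and> num_runs S = OPT M I"
proof -
  have "online_algorithm M M (\<lambda>S W. hd W)"
    using assms by (auto simp: online_algorithm_def uses_buffer_def neq_Nil_conv take_Cons')
  then have "\<exists>k S. achievable M I S \<and> num_runs S = k"
    using achievable_online_output[OF _ assms] by blast
  then show ?thesis unfolding OPT_def by (rule LeastI_ex)
qed

end

theory Submission imports Defs begin

text \<open>
  Up to order, a run written from the unwritten elements \<open>R\<close> is a set \<open>A \<subseteq> R\<close> in which every \<open>x\<close> has
  fewer than \<open>M + k\<close> predecessors in \<open>R\<close> in order of arrival, where \<open>k\<close> elements of \<open>A\<close> are written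
  before \<open>x\<close>. Such sets are closed under union, so there is a largest up-run \<open>U\<close> and a largest
  down-run \<open>D\<close>, and fewer unwritten elements never cost more runs. Suppose that \<open>U\<close> is the longer one.
  The algorithm then works in rounds of three maximal runs: up, up, down. The first two up-runs contain
  everything in \<open>D\<close>, and even everything in \<open>D\<close> followed by a maximal up-run; hence one round
  covers the first two runs of any solution, whatever their directions are, and if a single run
  suffices, then so does \<open>U\<close>. As \<open>U\<close> and \<open>D\<close> cannot both have length \<open>3 * M\<close>, the next \<open>4 * M\<close> elements
  determine which of them is the longer one.
\<close>

section \<open>Maximal runs\<close>

definition lt :: "bool \<Rightarrow> 'a::linorder \<Rightarrow> 'a \<Rightarrow> bool" where
  "lt d x y \<longleftrightarrow> (if d then x < y else y < x)"

lemma lt_irrefl [simp]: "\<not> lt d x x"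
  by (simp add: lt_def)

lemma lt_trans: "lt d x y \<Longrightarrow> lt d y z \<Longrightarrow> lt d x z"
  by (auto simp: lt_def split: if_splits)

lemma lt_total: "x \<noteq> y \<Longrightarrow> \<not> lt d x y \<Longrightarrow> lt d y x"
  by (auto simp: lt_def split: if_splits)

lemma lt_asym: "lt d x y \<Longrightarrow> \<not> lt d y x"
  using lt_trans lt_irrefl by blast

lemma lt_Not [simp]: "lt (\<not> d) x y \<longleftrightarrow> lt d y x"
  by (auto simp: lt_def)

definition least :: "bool \<Rightarrow> 'a::linorder set \<Rightarrow> 'a" where
  "least d A = (if d then Min A else Max A)"

lemma least_in: "finite A \<Longrightarrow> A \<noteq> {} \<Longrightarrow> least d A \<in> A"
  by (simp add: least_def)

lemma lt_least: "finite A \<Longrightarrow> a \<in> A \<Longrightarrow> a \<noteq> least d A \<Longrightarrow> lt d (least d A) a"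
  by (auto simp: least_def lt_def order.not_eq_order_implies_strict)

definition rk :: "('a \<Rightarrow> nat) \<Rightarrow> 'a set \<Rightarrow> 'a \<Rightarrow> nat" where
  "rk p R x = card {y \<in> R. p y < p x}"

text \<open>\<open>p\<close> gives the arrival times. If \<open>A\<close> is written in direction \<open>d\<close> (upwards for \<open>True\<close>), then
  \<open>x\<close> is written after \<open>card {y \<in> A. lt d y x}\<close> other elements, so it must be in the buffer by then.\<close>

definition feas :: "('a::linorder \<Rightarrow> nat) \<Rightarrow> nat \<Rightarrow> bool \<Rightarrow> 'a set \<Rightarrow> 'a set \<Rightarrow> bool" where
  "feas p M d R A \<longleftrightarrow> A \<subseteq> R \<and> (\<forall>x\<in>A. rk p R x < M + card {y \<in> A. lt d y x})"

text \<open>\<open>Q = UNIV\<close> gives a whole run; \<open>Q = {y. lt d l y}\<close> gives the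
  part still to be written of a run whose last element so far is \<open>l\<close>.\<close>

definition mrun :: "('a::linorder \<Rightarrow> nat) \<Rightarrow> nat \<Rightarrow> bool \<Rightarrow> 'a set \<Rightarrow> 'a set \<Rightarrow> 'a set" where
  "mrun p M d Q R = \<Union>{A. feas p M d R A \<and> A \<subseteq> Q}"

abbreviation rest :: "('a::linorder \<Rightarrow> nat) \<Rightarrow> nat \<Rightarrow> bool \<Rightarrow> 'a set \<Rightarrow> 'a set" where
  "rest p M d R \<equiv> R - mrun p M d UNIV R"

lemma rk_mono: "finite R \<Longrightarrow> p x \<le> p y \<Longrightarrow> rk p R x \<le> rk p R y"
  unfolding rk_def by (rule card_mono) auto

lemma rk_subset: "finite R \<Longrightarrow> R' \<subseteq> R \<Longrightarrow> rk p R' x \<le> rk p R x"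
  unfolding rk_def by (rule card_mono) auto

lemma rk_Diff:
  assumes "finite R" "A \<subseteq> R"
  shows "rk p R x = rk p (R - A) x + card {a \<in> A. p a < p x}"
proof -
  have "{y \<in> R. p y < p x} = {y \<in> R - A. p y < p x} \<union> {a \<in> A. p a < p x}"
    using assms by auto
  moreover have "card \<dots> = card {y \<in> R - A. p y < p x} + card {a \<in> A. p a < p x}"
    using assms finite_subset[OF assms(2,1)] by (intro card_Un_disjoint) auto
  ultimately show ?thesis by (simp add: rk_def)
qed

lemma rk_less_imp_less:
  assumes "finite R" "rk p R x < rk p R y"
  shows "p x < p y"
  using rk_mono[OF assms(1), of p y x] assms(2) by (meson linorder_not_less)

text \<open>The allowance \<open>card {y \<in> A. lt d y x}\<close> only grows with
  \<open>A\<close>, so the bound for each \<open>x\<close> survives in the union.\<close>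

lemma feas_mrun:
  assumes "finite R"
  shows "feas p M d R (mrun p M d Q R)"
  unfolding feas_def
proof (intro conjI ballI)
  show sub: "mrun p M d Q R \<subseteq> R" by (auto simp: mrun_def feas_def)
  fix x assume "x \<in> mrun p M d Q R"
  then obtain A where A: "feas p M d R A" "A \<subseteq> Q" "x \<in> A" by (auto simp: mrun_def)
  then have "A \<subseteq> mrun p M d Q R" by (auto simp: mrun_def)
  then have "card {y \<in> A. lt d y x} \<le> card {y \<in> mrun p M d Q R. lt d y x}"
    using finite_subset[OF sub assms] by (intro card_mono) auto
  moreover have "rk p R x < M + card {y \<in> A. lt d y x}" using A by (auto simp: feas_def)
  ultimately show "rk p R x < M + card {y \<in> mrun p M d Q R. lt d y x}" by linarith
qed

lemma mrun_subset: "mrun p M d Q R \<subseteq> R" "mrun p M d Q R \<subseteq> Q"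
  by (auto simp: mrun_def feas_def)

lemma feas_subset_mrun: "feas p M d R A \<Longrightarrow> A \<subseteq> Q \<Longrightarrow> A \<subseteq> mrun p M d Q R"
  by (auto simp: mrun_def)

lemma feas_subset: "feas p M d R A \<Longrightarrow> A \<subseteq> R"
  by (simp add: feas_def)

lemma feas_rk: "feas p M d R A \<Longrightarrow> x \<in> A \<Longrightarrow> rk p R x < M + card {y \<in> A. lt d y x}"
  by (simp add: feas_def)

lemma feas_rk_card:
  assumes "finite R" "feas p M d R A" "x \<in> A"
  shows "rk p R x < M + card A"
proof -
  have "card {y \<in> A. lt d y x} \<le> card A"
    using finite_subset[OF feas_subset assms(1)] assms by (intro card_mono) auto
  then show ?thesis using feas_rk[OF assms(2,3)] by linarith
qed

lemma mem_mrun: "x \<in> R \<Longrightarrow> x \<in> Q \<Longrightarrow> rk p R x < M \<Longrightarrow> x \<in> mrun p M d Q R"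
  using feas_subset_mrun[of p M d R "{x}" Q] by (simp add: feas_def)

text \<open>Removing \<open>y\<close> costs \<open>x\<close> at most one unit of allowance. When it
  does, either \<open>y\<close> arrived before \<open>x\<close> and the rank of \<open>x\<close>
  falls by one as well, or \<open>x\<close> ranks no higher than \<open>y\<close> and inherits the
  bound that holds for \<open>y\<close>.\<close>

lemma feas_remove:
  assumes "finite R" "feas p M d R A"
  shows "feas p M d (R - {y}) (A - {y})"
  unfolding feas_def
proof (intro conjI ballI)
  show "A - {y} \<subseteq> R - {y}" using assms by (auto simp: feas_def)
  fix x assume x: "x \<in> A - {y}"
  have AR: "A \<subseteq> R" and finA: "finite A"
    using assms finite_subset by (auto simp: feas_def)
  have *: "rk p R x < M + card {z \<in> A. lt d z x}" using assms(2) x by (simp add: feas_rk)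
  have rk: "rk p (R - {y}) x \<le> rk p R x" by (rule rk_subset) (use assms in auto)
  show "rk p (R - {y}) x < M + card {z \<in> A - {y}. lt d z x}"
  proof (cases "y \<in> A \<and> lt d y x")
    case False
    then have "{z \<in> A - {y}. lt d z x} = {z \<in> A. lt d z x}" by auto
    then show ?thesis using * rk by simp
  next
    case True
    have eq: "{z \<in> A. lt d z x} = insert y {z \<in> A - {y}. lt d z x}" using True by auto
    have card: "card {z \<in> A. lt d z x} = Suc (card {z \<in> A - {y}. lt d z x})"
      unfolding eq using finA by (subst card_insert_disjoint) auto
    show ?thesis
    proof (cases "p y < p x")
      case p: True
      have "rk p R x = rk p (R - {y}) x + card {a \<in> {y}. p a < p x}"
        by (rule rk_Diff) (use assms True AR in auto)
      moreover have "{a \<in> {y}. p a < p x} = {y}" using p by auto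
      ultimately show ?thesis using * card by simp
    next
      case False
      have "rk p R x \<le> rk p R y" using False by (intro rk_mono assms) simp
      also have "\<dots> < M + card {z \<in> A. lt d z y}" using assms True by (simp add: feas_rk)
      also have "card {z \<in> A. lt d z y} \<le> card {z \<in> A - {y}. lt d z x}"
        using finA True lt_trans by (intro card_mono) auto
      finally show ?thesis using rk by simp
    qed
  qed
qed

lemma feas_Diff:
  assumes "finite X" "finite R" "feas p M d R A"
  shows "feas p M d (R - X) (A - X)"
  using assms(1)
proof induction
  case (insert x X)
  then have "feas p M d (R - X - {x}) (A - X - {x})" using assms(2) by (intro feas_remove) auto
  then show ?case by (metis Diff_insert)
qed (use assms in simp)

lemma feas_restrict:
  assumes "finite R" "feas p M d R A" "R' \<subseteq> R"
  shows "feas p M d R' (A \<inter> R')"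
proof -
  have "feas p M d (R - (R - R')) (A - (R - R'))" using assms by (intro feas_Diff) auto
  moreover have "R - (R - R') = R'" "A - (R - R') = A \<inter> R'"
    using assms by (auto simp: feas_def)
  ultimately show ?thesis by simp
qed

lemma rest_mono:
  assumes "finite R" "R' \<subseteq> R"
  shows "rest p M d R' \<subseteq> rest p M d R"
  using feas_subset_mrun[OF feas_restrict[OF assms(1) feas_mrun[OF assms(1)] assms(2)]] assms(2)
  by blast

text \<open>These elements are in the buffer once the run \<open>A\<close> is written. If some
  element of \<open>A\<close> arrives no earlier than \<open>x\<close>, let \<open>a\<close> be the
  first such element in writing order: all that is written before \<open>a\<close> arrived before
  \<open>x\<close>, and \<open>x\<close> ranks no higher than \<open>a\<close>.\<close>

lemma rk_Diff_less:
  assumes R: "finite R" and A: "feas p M d R A" and less: "rk p R x < M + card A"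
  shows "rk p (R - A) x < M"
proof -
  have AR: "A \<subseteq> R" and finA: "finite A" using A R finite_subset by (auto simp: feas_def)
  note eq = rk_Diff[OF R AR, of p x]
  define Q where "Q = {a \<in> A. p x \<le> p a}"
  show ?thesis
  proof (cases "Q = {}")
    case True
    then have "{a \<in> A. p a < p x} = A" by (auto simp: Q_def not_less)
    then show ?thesis using eq less by simp
  next
    case False
    define a where "a = least d Q"
    have finQ: "finite Q" using finA by (simp add: Q_def)
    have a: "a \<in> Q" "\<And>b. b \<in> Q \<Longrightarrow> b \<noteq> a \<Longrightarrow> lt d a b"
      unfolding a_def using least_in[OF finQ False] lt_least[OF finQ] by auto
    have "{y \<in> A. lt d y a} \<subseteq> {a \<in> A. p a < p x}"
      using a lt_asym lt_irrefl by (fastforce simp: Q_def not_less)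
    then have "card {y \<in> A. lt d y a} \<le> card {a \<in> A. p a < p x}"
      using finA by (intro card_mono) auto
    moreover have "rk p R x \<le> rk p R a" using a R by (intro rk_mono) (auto simp: Q_def)
    moreover have "rk p R a < M + card {y \<in> A. lt d y a}"
      using A a by (intro feas_rk) (auto simp: Q_def)
    ultimately show ?thesis using eq by linarith
  qed
qed

lemma opposite_run_differences:
  assumes R: "finite R"
    and z: "z \<in> mrun p M d UNIV R" "z \<notin> mrun p M (\<not> d) UNIV R"
    and y: "y \<in> mrun p M (\<not> d) UNIV R" "y \<notin> mrun p M d UNIV R"
  shows "\<not> lt d z y"
proof
  \<comment> \<open>Whichever of \<open>z\<close> and \<open>y\<close> arrives first could be added to the run that misses it.\<close>
  assume zy: "lt d z y"
  have insert: "x \<in> mrun p M e UNIV R"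
    if w: "w \<in> mrun p M e UNIV R" and x: "x \<in> R" "p x \<le> p w" "lt e w x" for x w e
  proof -
    let ?A = "mrun p M e UNIV R"
    have A: "feas p M e R ?A" by (rule feas_mrun[OF R])
    have fin: "finite ?A" using finite_subset[OF feas_subset[OF A] R] .
    have le: "card {v \<in> ?A. lt e v u} \<le> card {v \<in> insert x ?A. lt e v u}" for u
      using fin by (intro card_mono) auto
    have "card {v \<in> ?A. lt e v w} \<le> card {v \<in> insert x ?A. lt e v x}"
      using fin x lt_trans by (intro card_mono) auto
    then have "rk p R x < M + card {v \<in> insert x ?A. lt e v x}"
      using rk_mono[OF R x(2)] feas_rk[OF A w] by linarith
    moreover have "rk p R u < M + card {v \<in> insert x ?A. lt e v u}" if "u \<in> ?A" for u
      using feas_rk[OF A that] le[of u] by linarith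
    ultimately have "feas p M e R (insert x ?A)"
      using x feas_subset[OF A] by (auto simp: feas_def)
    then show ?thesis using feas_subset_mrun by blast
  qed
  have "z \<in> R" "y \<in> R" using z y mrun_subset by blast+
  then show False
    using insert[of y "\<not> d" z] insert[of z d y] z y zy by (meson lt_Not nle_le)
qed

text \<open>Elements of \<open>D\<close> have rank below \<open>M + card D\<close>, so those that
  \<open>U\<close> misses are in the buffer once \<open>U\<close> is written, and a maximal run
  contains its whole initial buffer.\<close>

lemma shorter_run_covered:
  fixes p M d R
  defines "U \<equiv> mrun p M d UNIV R" and "D \<equiv> mrun p M (\<not> d) UNIV R"
  assumes R: "finite R" and le: "card D \<le> card U"
  shows "rest p M d (R - U) \<subseteq> R - D"
proof -
  have U: "feas p M d R U" and D: "feas p M (\<not> d) R D"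
    using feas_mrun[OF R] by (auto simp: U_def D_def)
  have "x \<in> mrun p M d UNIV (R - U)" if x: "x \<in> D" "x \<notin> U" for x
  proof (rule mem_mrun)
    show "x \<in> R - U" using x feas_subset[OF D] by auto
    show "rk p (R - U) x < M"
      using feas_rk_card[OF R D x(1)] le by (intro rk_Diff_less[OF R U]) linarith
  qed simp
  then show ?thesis by blast
qed

text \<open>It suffices that everything in \<open>D \<union> X\<close> that \<open>U\<close> misses
  can be written as one single run in direction \<open>d\<close> after \<open>U\<close>.\<close>

lemma shorter_longer_covered:
  fixes p M d R
  defines "U \<equiv> mrun p M d UNIV R" and "D \<equiv> mrun p M (\<not> d) UNIV R"
  assumes R: "finite R" and le: "card D \<le> card U"
  shows "rest p M d (R - U) \<subseteq> rest p M d (R - D)"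
proof -
  define X where "X = mrun p M d UNIV (R - D)"
  have U: "feas p M d R U" and D: "feas p M (\<not> d) R D" and X: "feas p M d (R - D) X"
    unfolding U_def D_def X_def using R by (auto intro: feas_mrun)
  note sub = feas_subset[OF U] feas_subset[OF D] feas_subset[OF X]
  have fin: "finite U" "finite D" "finite X"
    using finite_subset[OF sub(1) R] finite_subset[OF sub(2) R] finite_subset[OF sub(3) finite_Diff[OF R]]
    by simp_all
  define A where "A = (D \<union> X) - U"
  have "feas p M d (R - U) A"
    unfolding feas_def
  proof (intro conjI ballI)
    show "A \<subseteq> R - U" using sub by (auto simp: A_def)
    fix x assume x: "x \<in> A"
    show "rk p (R - U) x < M + card {y \<in> A. lt d y x}"
    \<comment> \<open>Elements of low rank are in the buffer after \<open>U\<close>. An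
      \<open>x\<close> of higher rank is outside \<open>D\<close>, and all of \<open>U\<close>
      arrived before it, so its rank falls by the full \<open>card U\<close>.\<close>
    proof (cases "rk p R x < M + card U")
      case True
      then show ?thesis using rk_Diff_less[OF R U] by (simp add: trans_less_add1)
    next
      case False
      then have xX: "x \<in> X" using x feas_rk_card[OF R D, of x] le by (auto simp: A_def)
      have "{a \<in> U. p a < p x} = U"
      proof -
        have "p a < p x" if "a \<in> U" for a
          using feas_rk_card[OF R U that] False by (intro rk_less_imp_less[OF R, of p]) linarith
        then show ?thesis by auto
      qed
      then have 1: "rk p R x = rk p (R - U) x + card U" using rk_Diff[OF R sub(1), of p x] by simp
      have "card {a \<in> D. p a < p x} \<le> card D" using fin by (intro card_mono) auto
      then have 2: "rk p R x < M + card {y \<in> X. lt d y x} + card D"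
        using rk_Diff[OF R sub(2), of p x] feas_rk[OF X xX] by linarith
      have "{y \<in> X. lt d y x} = {y \<in> X - U. lt d y x} \<union> {y \<in> X \<inter> U. lt d y x}" by auto
      also have "card \<dots> = card {y \<in> X - U. lt d y x} + card {y \<in> X \<inter> U. lt d y x}"
        using fin by (intro card_Un_disjoint) auto
      finally have 3: "card {y \<in> X. lt d y x} = card {y \<in> X - U. lt d y x} + card {y \<in> X \<inter> U. lt d y x}" .
      have "{y \<in> A. lt d y x} = {y \<in> X - U. lt d y x} \<union> {y \<in> D - U. lt d y x}"
        by (auto simp: A_def)
      also have "card \<dots> = card {y \<in> X - U. lt d y x} + card {y \<in> D - U. lt d y x}"
        using fin sub by (intro card_Un_disjoint) auto
      finally have 4: "card {y \<in> A. lt d y x} =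
        card {y \<in> X - U. lt d y x} + card {y \<in> D - U. lt d y x}" .
      \<comment> \<open>Compared with writing \<open>D\<close> and then \<open>X\<close>, the
        element \<open>x\<close> gains the right-hand side and loses the left-hand side.\<close>
      have 5: "card D + card {y \<in> X \<inter> U. lt d y x} \<le> card U + card {y \<in> D - U. lt d y x}"
      \<comment> \<open>If some \<open>y\<close> in \<open>D - U\<close> lies beyond
        \<open>x\<close>, then nothing of \<open>U - D\<close> precedes \<open>y\<close>, so nothing
        of \<open>X \<inter> U\<close> precedes \<open>x\<close>. Otherwise all of
        \<open>D - U\<close> counts, and \<open>D \<inter> U\<close> and \<open>X \<inter> U\<close>
        are disjoint parts of \<open>U\<close>.\<close>
      proof (cases "\<exists>y \<in> D - U. \<not> lt d y x")
        case True
        then obtain y where y: "y \<in> D" "y \<notin> U" "\<not> lt d y x" by auto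
        then have xy: "lt d x y" using xX sub by (intro lt_total) auto
        have "\<not> lt d z x" if "z \<in> X \<inter> U" for z
        proof -
          have "z \<in> U" "z \<notin> D" using that sub by auto
          then have "\<not> lt d z y"
            using y unfolding U_def D_def by (intro opposite_run_differences[OF R])
          then show ?thesis using lt_trans[OF _ xy] by blast
        qed
        then have "{y \<in> X \<inter> U. lt d y x} = {}" by auto
        then have "card {y \<in> X \<inter> U. lt d y x} = 0" by (simp only: card.empty)
        then show ?thesis using le by linarith
      next
        case False
        then have "{y \<in> D - U. lt d y x} = D - U" by auto
        then have "card {y \<in> D - U. lt d y x} = card (D - U)" by (rule arg_cong)
        moreover have "card D = card (D - U) + card (D \<inter> U)"
          using card_Int_Diff[OF fin(2), of U] by simp
        moreover have "card (D \<inter> U) + card {y \<in> X \<inter> U. lt d y x} =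
            card ((D \<inter> U) \<union> {y \<in> X \<inter> U. lt d y x})"
          using fin sub by (intro card_Un_disjoint[symmetric]) auto
        moreover have "\<dots> \<le> card U" using fin by (intro card_mono) auto
        ultimately show ?thesis by linarith
      qed
      show ?thesis using 1 2 3 4 5 by linarith
    qed
  qed
  then have "A \<subseteq> mrun p M d UNIV (R - U)" by (rule feas_subset_mrun) simp
  then show ?thesis unfolding A_def X_def[symmetric] by blast
qed

section \<open>Solutions made of maximal runs\<close>

fun reach :: "('a::linorder \<Rightarrow> nat) \<Rightarrow> nat \<Rightarrow> nat \<Rightarrow> 'a set \<Rightarrow> bool" where
  "reach p M 0 R \<longleftrightarrow> R = {}"
| "reach p M (Suc k) R \<longleftrightarrow> (\<exists>d. reach p M k (rest p M d R))"

lemma reach_mono: "finite R \<Longrightarrow> R' \<subseteq> R \<Longrightarrow> reach p M k R \<Longrightarrow> reach p M k R'"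
proof (induction k arbitrary: R R')
  case (Suc k)
  then obtain d where "reach p M k (rest p M d R)" by auto
  then have "reach p M k (rest p M d R')"
    using Suc.IH[OF _ rest_mono[OF Suc.prems(1,2)]] Suc.prems by blast
  then show ?case by auto
qed auto

text \<open>Let the solution begin with directions \<open>e\<close> and \<open>f\<close>. If
  \<open>f = d\<close>, the first two runs of the round already cover both; if not, these two cover
  the run in direction \<open>e\<close>, and the third one then matches \<open>f\<close>.\<close>

lemma three_runs_cover_two:
  assumes R: "finite R"
    and le: "card (mrun p M (\<not> d) UNIV R) \<le> card (mrun p M d UNIV R)"
    and reach: "reach p M (Suc (Suc k)) R"
  shows "reach p M k (rest p M (\<not> d) (rest p M d (rest p M d R)))"
proof -
  obtain e f where ef: "reach p M k (rest p M f (rest p M e R))" using reach by auto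
  have fin: "finite (rest p M a X)" if "finite X" for a X using that by simp
  have "rest p M (\<not> d) (rest p M d (rest p M d R)) \<subseteq> rest p M f (rest p M e R)"
  proof (cases "f = d")
    case True
    have "rest p M d (rest p M d R) \<subseteq> rest p M d (rest p M e R)"
      using shorter_longer_covered[OF R le] by (cases "e = d") auto
    then show ?thesis using True by blast
  next
    case False
    then have f: "f = (\<not> d)" by simp
    have "rest p M d (rest p M d R) \<subseteq> rest p M e R"
      using shorter_run_covered[OF R le] by (cases "e = d") auto
    then show ?thesis unfolding f by (rule rest_mono[OF fin[OF R]])
  qed
  then show ?thesis using ef R by (meson reach_mono finite_Diff)
qed

text \<open>A run that exhausts \<open>R\<close> has \<open>card R\<close> elements, and then so has
  the longer one.\<close>

lemma longer_run_covers_one: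
  assumes R: "finite R"
    and le: "card (mrun p M (\<not> d) UNIV R) \<le> card (mrun p M d UNIV R)"
    and reach: "reach p M 1 R"
  shows "rest p M d R = {}"
proof -
  obtain e where "rest p M e R = {}" using reach by (auto simp: One_nat_def)
  then have e: "mrun p M e UNIV R = R" using mrun_subset by blast
  have "card R \<le> card (mrun p M d UNIV R)" using e le by (cases "e = d") auto
  then have "mrun p M d UNIV R = R" using R mrun_subset(1) by (metis card_seteq)
  then show ?thesis by simp
qed

text \<open>This lets a greedy choice produce a maximal run without knowing it in advance. The first
  element of a run must be in the buffer, so it does not precede \<open>c\<close>; and putting
  \<open>c\<close> in front raises every later allowance by one, but every rank by at most
  one.\<close>

lemma mrun_step:
  assumes R: "finite R" and Q: "\<And>x y. x \<in> Q \<Longrightarrow> lt d x y \<Longrightarrow> y \<in> Q"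
    and c: "c \<in> R" "c \<in> Q" "rk p R c < M"
    and least: "\<And>x. x \<in> R \<Longrightarrow> x \<in> Q \<Longrightarrow> rk p R x < M \<Longrightarrow> x \<noteq> c \<Longrightarrow> lt d c x"
  shows "mrun p M d Q R = insert c (mrun p M d {y. lt d c y} (R - {c}))"
proof
  let ?A = "mrun p M d Q R" and ?A' = "mrun p M d {y. lt d c y} (R - {c})"
  have A: "feas p M d R ?A" and A': "feas p M d (R - {c}) ?A'" using R by (auto intro: feas_mrun)
  have finA: "finite ?A" "finite ?A'" using R mrun_subset by (meson finite_subset finite_Diff)+
  have cA: "c \<in> ?A" using c by (intro mem_mrun)
  have "lt d c x" if x: "x \<in> ?A - {c}" for x
  proof -
    define a where "a = least d ?A"
    have a: "a \<in> ?A" "\<And>b. b \<in> ?A \<Longrightarrow> b \<noteq> a \<Longrightarrow> lt d a b"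
      unfolding a_def using least_in[OF finA(1)] lt_least[OF finA(1)] cA by auto
    then have "{y \<in> ?A. lt d y a} = {}" using lt_asym lt_irrefl by blast
    then have "rk p R a < M" using feas_rk[OF A a(1)] by (simp only: card.empty add_0_right)
    then have "a = c \<or> lt d c a" using least[of a] a(1) mrun_subset by blast
    then show ?thesis using a(2)[of x] x lt_trans by (cases "x = a") auto
  qed
  then have "?A - {c} \<subseteq> ?A'" using feas_remove[OF R A] by (intro feas_subset_mrun) auto
  then show "?A \<subseteq> insert c ?A'" by auto
  have "feas p M d R (insert c ?A')"
    unfolding feas_def
  proof (intro conjI ballI)
    show "insert c ?A' \<subseteq> R" using feas_subset[OF A'] c by auto
    fix x assume "x \<in> insert c ?A'"
    then consider "x = c" | "x \<in> ?A'" by auto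
    then show "rk p R x < M + card {y \<in> insert c ?A'. lt d y x}"
    proof cases
      case 1
      then show ?thesis using c by simp
    next
      case 2
      then have cx: "lt d c x" using mrun_subset by blast
      have "{y \<in> insert c ?A'. lt d y x} = insert c {y \<in> ?A'. lt d y x}" using cx by auto
      moreover have "c \<notin> ?A'" using feas_subset[OF A'] by auto
      ultimately have "card {y \<in> insert c ?A'. lt d y x} = Suc (card {y \<in> ?A'. lt d y x})"
        using finA by simp
      moreover have "card {a \<in> {c}. p a < p x} \<le> card {c}" by (intro card_mono) auto
      then have "rk p R x \<le> Suc (rk p (R - {c}) x)"
        using rk_Diff[OF R, of "{c}" p x] c by simp
      ultimately show ?thesis using feas_rk[OF A' 2] by linarith
    qed
  qed
  moreover have "insert c ?A' \<subseteq> Q" using c Q mrun_subset(2)[of p M d "{y. lt d c y}"] by blast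
  ultimately show "insert c ?A' \<subseteq> ?A" by (rule feas_subset_mrun)
qed

text \<open>The first element of a nonempty run would have to be in the buffer already.\<close>

lemma mrun_empty:
  assumes R: "finite R" and none: "\<And>x. x \<in> R \<Longrightarrow> x \<in> Q \<Longrightarrow> \<not> rk p R x < M"
  shows "mrun p M d Q R = {}"
proof (rule ccontr)
  let ?A = "mrun p M d Q R"
  assume ne: "?A \<noteq> {}"
  have A: "feas p M d R ?A" using R by (rule feas_mrun)
  have finA: "finite ?A" using R mrun_subset by (meson finite_subset)
  define a where "a = least d ?A"
  have a: "a \<in> ?A" "\<And>b. b \<in> ?A \<Longrightarrow> b \<noteq> a \<Longrightarrow> lt d a b"
    unfolding a_def using least_in[OF finA ne] lt_least[OF finA] by auto
  then have "{y \<in> ?A. lt d y a} = {}" using lt_asym lt_irrefl by blast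
  then have "rk p R a < M" using feas_rk[OF A a(1)] by (simp only: card.empty add_0_right)
  then show False using none[of a] a(1) mrun_subset by blast
qed

section \<open>The longer run is visible\<close>

text \<open>\<open>B\<close> consists of the first \<open>q\<close> elements written; each has at
  most \<open>q - 1\<close> written before it, whence the rank bound.\<close>

lemma feas_initial_segment:
  assumes "finite R" "feas p M d R A" "q \<le> card A"
  shows "\<exists>B\<subseteq>A. card B = q \<and> (\<forall>x\<in>B. \<forall>y\<in>A - B. lt d x y) \<and> (\<forall>x\<in>B. rk p R x < M + q - 1)"
proof -
  have finA: "finite A" using finite_subset[OF feas_subset] assms by blast
  have "\<exists>B\<subseteq>A. card B = q \<and> (\<forall>x\<in>B. \<forall>y\<in>A - B. lt d x y)"
    using assms(3)
  proof (induction q)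
    case 0
    then show ?case by (intro exI[of _ "{}"]) auto
  next
    case (Suc q)
    then obtain B where B: "B \<subseteq> A" "card B = q" "\<forall>x\<in>B. \<forall>y\<in>A - B. lt d x y" by auto
    have fin: "finite B" "finite (A - B)" using finA B finite_subset by auto
    have ne: "A - B \<noteq> {}" using Suc.prems B finA by (metis Diff_eq_empty_iff card_mono fin(1) not_less_eq_eq)
    define a where "a = least d (A - B)"
    have a: "a \<in> A - B" unfolding a_def by (rule least_in[OF fin(2) ne])
    have "lt d a y" if "y \<in> A - B" "y \<noteq> a" for y
      using lt_least[OF fin(2) that(1)] that(2) by (simp add: a_def)
    then show ?case using a B fin by (intro exI[of _ "insert a B"]) auto
  qed
  then obtain B where B: "B \<subseteq> A" "card B = q" "\<forall>x\<in>B. \<forall>y\<in>A - B. lt d x y" by auto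
  have "rk p R x < M + q - 1" if x: "x \<in> B" for x
  proof -
    have fin: "finite B" using B finA finite_subset by auto
    have "{y \<in> A. lt d y x} \<subseteq> B - {x}" using B x lt_asym lt_irrefl by blast
    then have "card {y \<in> A. lt d y x} \<le> card (B - {x})" using fin by (intro card_mono) auto
    also have "\<dots> = q - 1" using B x fin by simp
    finally have "card {y \<in> A. lt d y x} \<le> q - 1" .
    moreover have "q > 0" using B x fin card_gt_0_iff by blast
    moreover have "rk p R x < M + card {y \<in> A. lt d y x}"
      using assms(2) B x by (intro feas_rk) auto
    ultimately show ?thesis by linarith
  qed
  then show ?thesis using B by blast
qed

lemma card_rk_less:
  assumes R: "finite R" and inj: "inj_on p R"
  shows "card {x \<in> R. rk p R x < m} \<le> m"
proof -
  have less: "rk p R x < rk p R y" if "x \<in> R" "p x < p y" for x y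
    unfolding rk_def using that R by (intro psubset_card_mono) auto
  have "inj_on (rk p R) {x \<in> R. rk p R x < m}"
  proof (rule inj_onI)
    fix x y assume xy: "x \<in> {x \<in> R. rk p R x < m}" "y \<in> {x \<in> R. rk p R x < m}"
      and eq: "rk p R x = rk p R y"
    have "\<not> p x < p y" "\<not> p y < p x" using less[of x y] less[of y x] xy eq by auto
    then show "x = y" using inj xy by (auto dest: inj_onD)
  qed
  then have "card {x \<in> R. rk p R x < m} \<le> card {..<m}" by (rule card_inj_on_le) auto
  then show ?thesis by simp
qed

text \<open>The first \<open>M\<close> elements of either run are among the first
  \<open>2 * M - 1\<close> arrivals, so the two share some \<open>z\<close>. The first
  \<open>3 * M\<close> elements of either run are among the first \<open>4 * M - 1\<close> arrivals,
  so at least \<open>2 * M + 1\<close> of them are shared. A shared element outside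
  \<open>A1 \<union> B1\<close> would follow \<open>z\<close> in both directions, so all of them lie
  in a set of at most \<open>2 * M - 1\<close> elements.\<close>

lemma not_both_runs_long:
  assumes R: "finite R" and inj: "inj_on p R" and M: "M > 0"
    and A: "feas p M d R A" "3 * M \<le> card A" and B: "feas p M (\<not> d) R B" "3 * M \<le> card B"
  shows False
proof -
  have "M \<le> card A" "M \<le> card B" using A B by auto
  then obtain A1 B1 where
    A1: "A1 \<subseteq> A" "card A1 = M" "\<forall>x\<in>A1. \<forall>y\<in>A - A1. lt d x y" "\<forall>x\<in>A1. rk p R x < M + M - 1" and
    B1: "B1 \<subseteq> B" "card B1 = M" "\<forall>x\<in>B1. \<forall>y\<in>B - B1. lt (\<not> d) x y" "\<forall>x\<in>B1. rk p R x < M + M - 1"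
    using feas_initial_segment[OF R A(1)] feas_initial_segment[OF R B(1)] by metis
  obtain A3 B3 where
    A3: "A3 \<subseteq> A" "card A3 = 3 * M" "\<forall>x\<in>A3. rk p R x < M + 3 * M - 1" and
    B3: "B3 \<subseteq> B" "card B3 = 3 * M" "\<forall>x\<in>B3. rk p R x < M + 3 * M - 1"
    using feas_initial_segment[OF R A(1) A(2)] feas_initial_segment[OF R B(1) B(2)] by metis
  note sub = feas_subset[OF A(1)] feas_subset[OF B(1)]
  have fin: "finite A1" "finite B1" "finite A3" "finite B3"
    using R sub A1(1) B1(1) A3(1) B3(1) by (meson finite_subset)+
  have "card (A1 \<union> B1) \<le> card {x \<in> R. rk p R x < M + M - 1}"
    using A1 B1 sub R by (intro card_mono) auto
  also have "\<dots> \<le> M + M - 1" by (rule card_rk_less[OF R inj])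
  finally have 1: "card (A1 \<union> B1) \<le> M + M - 1" .
  have "card (A3 \<union> B3) \<le> card {x \<in> R. rk p R x < M + 3 * M - 1}"
    using A3 B3 sub R by (intro card_mono) auto
  also have "\<dots> \<le> M + 3 * M - 1" by (rule card_rk_less[OF R inj])
  finally have 3: "card (A3 \<union> B3) \<le> M + 3 * M - 1" .
  have "card (A1 \<inter> B1) > 0" using card_Un_Int[OF fin(1,2)] A1 B1 1 M by linarith
  then obtain z where z: "z \<in> A1" "z \<in> B1" by (metis IntE card_gt_0_iff ex_in_conv)
  have "y \<in> A1 \<union> B1" if y: "y \<in> A3 \<inter> B3" for y
  proof (rule ccontr)
    assume "y \<notin> A1 \<union> B1"
    then have "lt d z y" "lt (\<not> d) z y" using y z A1(3) B1(3) A3(1) B3(1) by auto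
    then show False using lt_asym by auto
  qed
  then have "card (A3 \<inter> B3) \<le> card (A1 \<union> B1)" using fin by (intro card_mono) auto
  then show False using card_Un_Int[OF fin(3,4)] A3 B3 1 3 M by linarith
qed

text \<open>\<open>V\<close> contains all arrivals earlier than any of its elements, so on
  \<open>V\<close> the ranks in \<open>V\<close> and \<open>R\<close> agree. A run of at most
  \<open>3 * M\<close> elements fits into \<open>V\<close>, because its ranks stay below
  \<open>M + 3 * M\<close>.\<close>

lemma longer_run_visible:
  fixes p M R
  defines "V \<equiv> {x \<in> R. rk p R x < 4 * M}"
  assumes R: "finite R" and inj: "inj_on p R" and M: "M > 0"
    and le: "card (mrun p M (\<not> d) UNIV V) \<le> card (mrun p M d UNIV V)"
  shows "card (mrun p M (\<not> d) UNIV R) \<le> card (mrun p M d UNIV R)"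
proof -
  have VR: "V \<subseteq> R" and finV: "finite V" and injV: "inj_on p V"
    using R inj_on_subset[OF inj] by (auto simp: V_def)
  have rk: "rk p V x = rk p R x" if "x \<in> V" for x
  proof -
    have "rk p R y < 4 * M" if "p y < p x" for y
      using rk_mono[OF R, of p y x] that \<open>x \<in> V\<close> by (auto simp: V_def)
    then have "{y \<in> V. p y < p x} = {y \<in> R. p y < p x}" by (auto simp: V_def)
    then show ?thesis by (simp add: rk_def)
  qed
  have fin: "finite (mrun p M e UNIV R)" for e using mrun_subset R by (meson finite_subset)
  have finv: "finite (mrun p M e UNIV V)" for e using mrun_subset finV by (meson finite_subset)
  have subV: "mrun p M e UNIV R \<inter> V \<subseteq> mrun p M e UNIV V" for e
    by (rule feas_subset_mrun[OF feas_restrict[OF R feas_mrun[OF R] VR]]) simp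
  have sub: "mrun p M e UNIV V \<subseteq> mrun p M e UNIV R" for e
  proof (rule feas_subset_mrun)
    have "feas p M e V (mrun p M e UNIV V)" by (rule feas_mrun[OF finV])
    then show "feas p M e R (mrun p M e UNIV V)" using rk VR unfolding feas_def by (metis subset_iff)
  qed simp
  have short: "mrun p M e UNIV V = mrun p M e UNIV R" if "card (mrun p M e UNIV R) \<le> 3 * M" for e
  proof -
    have "mrun p M e UNIV R \<subseteq> V"
      using feas_rk_card[OF R feas_mrun[OF R], of _ p M e UNIV] that mrun_subset(1)[of p M e UNIV R]
      by (fastforce simp: V_def)
    then show ?thesis using sub subV by blast
  qed
  have long: "3 * M \<le> card (mrun p M e UNIV V)" if e: "3 * M \<le> card (mrun p M e UNIV R)" for e
  proof -
    obtain B where B: "B \<subseteq> mrun p M e UNIV R" "card B = 3 * M"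
      "\<forall>x\<in>B. rk p R x < M + 3 * M - 1"
      using feas_initial_segment[OF R feas_mrun[OF R] e] by metis
    then have "B \<subseteq> V" using mrun_subset(1)[of p M e UNIV R] by (fastforce simp: V_def)
    then have "B \<subseteq> mrun p M e UNIV V" using B subV by blast
    then show ?thesis using B card_mono[OF finv] by metis
  qed
  show ?thesis
  proof (cases "card (mrun p M (\<not> d) UNIV R) \<le> 3 * M")
    case True
    then have "card (mrun p M (\<not> d) UNIV R) \<le> card (mrun p M d UNIV V)" using short le by metis
    also have "\<dots> \<le> card (mrun p M d UNIV R)" by (rule card_mono[OF fin sub])
    finally show ?thesis .
  next
    case False
    \<comment> \<open>If the opposite run exceeds \<open>3 * M\<close>, both runs of
      \<open>V\<close> would have at least \<open>3 * M\<close> elements.\<close>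
    then have l: "3 * M \<le> card (mrun p M (\<not> d) UNIV V)" by (intro long) simp
    then have "3 * M \<le> card (mrun p M d UNIV V)" using le by simp
    then show ?thesis
      using not_both_runs_long[OF finV injV M feas_mrun[OF finV] _ feas_mrun[OF finV] l] by blast
  qed
qed

section \<open>Arrival order of a list\<close>

lemma sorted_wrt_distinct:
  assumes "sorted_wrt (\<lambda>x y. p x < (p y :: nat)) W"
  shows "distinct W"
  using assms by (induction W) auto

lemma sorted_wrt_inj_on:
  assumes "sorted_wrt (\<lambda>x y. p x < (p y :: nat)) W"
  shows "inj_on p (set W)"
  using assms by (induction W) auto

lemma sorted_wrt_less_iff:
  assumes "sorted_wrt (\<lambda>x y. p x < (p y :: nat)) W" "i < length W" "j < length W"
  shows "p (W ! i) < p (W ! j) \<longleftrightarrow> i < j"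
  using assms unfolding sorted_wrt_iff_nth_less
  by (metis less_asym less_irrefl linorder_neqE_nat)

lemma set_take_conv: "set (take m W) = {W ! j | j. j < m \<and> j < length W}"
  by (auto simp: set_conv_nth) (metis nth_take)

lemma rk_nth:
  assumes W: "sorted_wrt (\<lambda>x y. p x < (p y :: nat)) W" and i: "i < length W"
  shows "rk p (set W) (W ! i) = i"
proof -
  have "{y \<in> set W. p y < p (W ! i)} = set (take i W)"
    using i sorted_wrt_less_iff[OF W] unfolding set_take_conv unfolding set_conv_nth
    by (auto intro: order.strict_trans)
  moreover have "card (set (take i W)) = i"
    using i sorted_wrt_distinct[OF W] by (simp add: distinct_card)
  ultimately show ?thesis by (simp add: rk_def)
qed

text \<open>Translates the buffer (\<open>m = M\<close>) and the visible window
  (\<open>m = 4 * M\<close>) into rank conditions.\<close>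

lemma set_take_eq:
  assumes W: "sorted_wrt (\<lambda>x y. p x < (p y :: nat)) W"
  shows "set (take m W) = {x \<in> set W. rk p (set W) x < m}"
proof -
  have "x \<in> set (take m W) \<longleftrightarrow> rk p (set W) x < m" if "x \<in> set W" for x
  proof -
    obtain i where i: "i < length W" "x = W ! i" using \<open>x \<in> set W\<close> by (metis in_set_conv_nth)
    then have "x \<in> set (take m W) \<longleftrightarrow> i < m"
      using sorted_wrt_distinct[OF W] by (auto simp: set_take_conv nth_eq_iff_index_eq)
    then show ?thesis using i rk_nth[OF W] by simp
  qed
  then show ?thesis using set_take_subset[of m W] by auto
qed

text \<open>Only the order of arrivals matters, so positions within the visible list may replace the
  arrival times \<open>p\<close>, which the algorithm does not know.\<close>

lemma mrun_cong:
  assumes "\<And>x y. x \<in> R \<Longrightarrow> y \<in> R \<Longrightarrow> p x < p y \<longleftrightarrow> q x < q y"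
  shows "mrun p M d Q R = mrun q M d Q R"
proof -
  have "rk p R x = rk q R x" if "x \<in> R" for x
    unfolding rk_def using assms that by (metis (no_types, lifting))
  then have "feas p M d R A \<longleftrightarrow> feas q M d R A" for A by (auto simp: feas_def subset_iff)
  then show ?thesis by (simp add: mrun_def)
qed

definition pos :: "'a list \<Rightarrow> 'a \<Rightarrow> nat" where
  "pos L x = length (takeWhile (\<lambda>y. y \<noteq> x) L)"

lemma sorted_wrt_pos: "distinct L \<Longrightarrow> sorted_wrt (\<lambda>x y. pos L x < pos L y) L"
proof (induction L)
  case (Cons a L)
  then have "sorted_wrt (\<lambda>x y. pos L x < pos L y) L" by simp
  then have "sorted_wrt (\<lambda>x y. pos (a # L) x < pos (a # L) y) L"
    by (rule sorted_wrt_mono_rel[rotated]) (use Cons.prems in \<open>auto simp: pos_def\<close>)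
  then show ?case using Cons.prems by (auto simp: pos_def)
qed simp

definition decide :: "nat \<Rightarrow> 'a::linorder list \<Rightarrow> bool" where
  "decide M V \<longleftrightarrow>
    card (mrun (pos V) M False UNIV (set V)) \<le> card (mrun (pos V) M True UNIV (set V))"

lemma decide_longer:
  assumes W: "sorted_wrt (\<lambda>x y. p x < (p y :: nat)) W" and M: "M > 0"
    and d: "d = decide M (take (4 * M) W)"
  shows "card (mrun p M (\<not> d) UNIV (set W)) \<le> card (mrun p M d UNIV (set W))"
proof -
  define V where "V = take (4 * M) W"
  have V: "sorted_wrt (\<lambda>x y. p x < p y) V" using W by (simp add: V_def sorted_wrt_take)
  have pV: "sorted_wrt (\<lambda>x y. pos V x < pos V y) V"
    using sorted_wrt_pos sorted_wrt_distinct[OF V] by blast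
  have "mrun p M e UNIV (set V) = mrun (pos V) M e UNIV (set V)" for e
    by (rule mrun_cong) (metis in_set_conv_nth sorted_wrt_less_iff[OF V] sorted_wrt_less_iff[OF pV])
  then have le: "card (mrun p M (\<not> d) UNIV (set V)) \<le> card (mrun p M d UNIV (set V))"
    unfolding d decide_def V_def[symmetric] by (cases "decide M V") (auto simp: decide_def)
  have "set V = {x \<in> set W. rk p (set W) x < 4 * M}" unfolding V_def by (rule set_take_eq[OF W])
  then show ?thesis
    using longer_run_visible[OF _ sorted_wrt_inj_on[OF W] M] le by simp
qed

section \<open>The online algorithm\<close>

text \<open>The state of the algorithm must be recovered from its output. \<open>Run j d l\<close>: the current run is
  number \<open>j\<close> (from 0) of its round, goes in direction \<open>d\<close> and has last element \<open>l\<close>. After \<open>First l\<close>, the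
  first element of a round, the direction is not yet visible in the output. It is then read off from a
  comparison with any other element of the buffer, which needs \<open>M \<ge> 2\<close>.\<close>

datatype 'a phase = Start | First 'a | Run nat bool 'a

text \<open>The algorithm leaves a run only when no buffer element lies beyond its last element
  \<open>l\<close>, so an element not beyond \<open>l\<close> marks the start of the next
  run.\<close>

fun next_phase :: "'a::linorder phase \<Rightarrow> 'a \<Rightarrow> 'a phase" where
  "next_phase Start x = First x"
| "next_phase (First l) x = Run 0 (l < x) x"
| "next_phase (Run j d l) x =
    (if lt d l x then Run j d x
     else if j = 0 then Run 1 d x
     else if j = 1 then Run 2 (\<not> d) x
     else First x)"

definition phase :: "'a::linorder list \<Rightarrow> 'a phase" where
  "phase S = foldl next_phase Start S"

lemma phase_simps [simp]: "phase [] = Start" "phase (S @ [x]) = next_phase (phase S) x"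
  by (simp_all add: phase_def)

definition view :: "'a::linorder list \<Rightarrow> 'a list \<Rightarrow> 'a phase" where
  "view S V = (case phase S of First l \<Rightarrow> Run 0 (l < hd V) l | s \<Rightarrow> s)"

text \<open>By \<open>mrun_step\<close>, the least buffer element beyond \<open>l\<close> continues
  a maximal run; by \<open>mrun_empty\<close>, the run is complete if there is none. The remaining
  branches open the second run, the third run and a new round.\<close>

fun select :: "nat \<Rightarrow> 'a::linorder list \<Rightarrow> 'a phase \<Rightarrow> 'a" where
  "select M V (Run j d l) =
    (let B = set (take M V); C = {y \<in> B. lt d l y} in
     if C \<noteq> {} then least d C
     else if j = 0 then least d B
     else if j = 1 then least (\<not> d) B
     else least (decide M V) B)"
| "select M V _ = least (decide M V) (set (take M V))"

definition alg :: "nat \<Rightarrow> 'a::linorder algorithm" where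
  "alg M S V = select M V (view S V)"

lemma select_in:
  assumes "M > 0" "V \<noteq> []"
  shows "select M V s \<in> set (take M V)"
proof -
  have ne: "set (take M V) \<noteq> {}" using assms by simp
  show ?thesis
  proof (cases s)
    case (Run j d l)
    let ?C = "{y \<in> set (take M V). lt d l y}"
    have "least d ?C \<in> ?C" if "?C \<noteq> {}" using that by (intro least_in) auto
    then show ?thesis using Run least_in[OF finite_set ne] by (auto simp: Let_def)
  qed (use least_in[OF finite_set ne] in auto)
qed

lemma online_algorithm_alg: "M > 0 \<Longrightarrow> online_algorithm M (4 * M) (alg M)"
  by (auto simp: online_algorithm_def uses_buffer_def alg_def select_in)

section \<open>Splitting the output into runs\<close>

definition splits :: "nat \<Rightarrow> bool \<Rightarrow> 'a::linorder \<Rightarrow> 'a list \<Rightarrow> bool" where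
  "splits n d l S \<longleftrightarrow> (\<exists>rs r. S = concat rs @ r \<and> (\<forall>r\<in>set rs. is_run r) \<and>
    Suc (length rs) = n \<and> sorted_wrt (lt d) r \<and> r \<noteq> [] \<and> last r = l)"

lemma sorted_wrt_lt_is_run: "sorted_wrt (lt d) r \<Longrightarrow> is_run r"
  unfolding is_run_def sorted_wrt_rev
  by (cases d) (auto simp: lt_def intro: sorted_wrt_mono_rel[rotated])

lemma splits_new:
  assumes "splits n d l S"
  shows "splits (Suc n) d' x (S @ [x])"
proof -
  obtain rs r where "S = concat rs @ r" "\<forall>r\<in>set rs. is_run r" "Suc (length rs) = n"
    "sorted_wrt (lt d) r"
    using assms by (auto simp: splits_def)
  then have "S @ [x] = concat (rs @ [r]) @ [x] \<and> (\<forall>r\<in>set (rs @ [r]). is_run r) \<and>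
      Suc (length (rs @ [r])) = Suc n"
    using sorted_wrt_lt_is_run by auto
  then show ?thesis
    unfolding splits_def by (intro exI[of _ "rs @ [r]"] exI[of _ "[x]"]) auto
qed

lemma splits_first: "splits 1 d x [x]"
  unfolding splits_def by (intro exI[of _ "[]"] exI[of _ "[x]"]) auto

lemma splits_extend:
  assumes "splits n d l S" "lt d l x"
  shows "splits n d x (S @ [x])"
proof -
  obtain rs r where r: "S = concat rs @ r" "\<forall>r\<in>set rs. is_run r" "Suc (length rs) = n"
    "sorted_wrt (lt d) r" "r \<noteq> []" "last r = l"
    using assms by (auto simp: splits_def)
  have "lt d y x" if "y \<in> set r" for y
  proof -
    have "r = butlast r @ [l]" using r by (metis append_butlast_last_id)
    then have "y = l \<or> lt d y l"
      using r(4) that by (metis Un_iff empty_iff list.set(1) set_ConsD set_append sorted_wrt_append list.set_intros(1))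
    then show ?thesis using assms(2) lt_trans by auto
  qed
  then have "sorted_wrt (lt d) (r @ [x])" using r by (auto simp: sorted_wrt_append)
  then show ?thesis
    unfolding splits_def using r by (intro exI[of _ rs] exI[of _ "r @ [x]"]) auto
qed

lemma splits_num_runs:
  assumes "splits n d l S"
  shows "num_runs S \<le> n"
proof -
  obtain rs r where "S = concat rs @ r" "\<forall>r\<in>set rs. is_run r" "Suc (length rs) = n"
    "sorted_wrt (lt d) r"
    using assms by (auto simp: splits_def)
  then have "\<exists>rs. length rs = n \<and> concat rs = S \<and> (\<forall>r\<in>set rs. is_run r)"
    using sorted_wrt_lt_is_run by (intro exI[of _ "rs @ [r]"]) auto
  then show ?thesis unfolding num_runs_def by (rule Least_le)
qed

section \<open>Counting runs over a round\<close>

definition after :: "('a::linorder \<Rightarrow> nat) \<Rightarrow> nat \<Rightarrow> nat \<Rightarrow> bool \<Rightarrow> 'a set \<Rightarrow> 'a set" where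
  "after p M j d R =
    (if j = 0 then rest p M (\<not> d) (rest p M d R)
     else if j = 1 then rest p M (\<not> d) R else R)"

text \<open>With \<open>n\<close> runs begun, \<open>R\<close> is what will remain after the current run and \<open>after p M j d R\<close>
  what will remain after the current round.\<close>

definition budget ::
    "('a::linorder \<Rightarrow> nat) \<Rightarrow> nat \<Rightarrow> nat \<Rightarrow> nat \<Rightarrow> bool \<Rightarrow> nat \<Rightarrow> 'a set \<Rightarrow> bool" where
  "budget p M K j d n R \<longleftrightarrow> R = {} \<and> 2 * n \<le> 3 * K \<or>
    (\<exists>k. reach p M k (after p M j d R) \<and> 2 * (n + (2 - j)) + 3 * k \<le> 3 * K)"

text \<open>For \<open>k \<ge> 2\<close>, two runs of the solution are traded for three, and
  \<open>2 * 3 = 3 * 2\<close>. For \<open>k = 1\<close> the new run is the last one and costs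
  \<open>2\<close> out of the remaining \<open>3\<close>.\<close>

lemma budget_round:
  assumes R: "finite R" "R \<noteq> {}" and k: "reach p M k R" "2 * n + 3 * k \<le> 3 * K"
    and le: "card (mrun p M (\<not> d) UNIV R) \<le> card (mrun p M d UNIV R)"
  shows "budget p M K 0 d (Suc n) (rest p M d R)"
proof -
  consider "k = 0" | "k = 1" | k' where "k = Suc (Suc k')"
    by (metis One_nat_def not0_implies_Suc)
  then show ?thesis
  proof cases
    case 1
    then show ?thesis using R k by simp
  next
    case 2
    then show ?thesis using longer_run_covers_one[OF R(1) le] k by (simp add: budget_def)
  next
    case 3
    then have "reach p M k' (after p M 0 d (rest p M d R))"
      using three_runs_cover_two[OF R(1) le] k by (simp add: after_def)
    then show ?thesis unfolding budget_def using k(2) 3 by (intro disjI2 exI[of _ k']) auto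
  qed
qed

text \<open>Opening the next planned run of a round changes neither what remains after the round nor
  the number of runs begun by then.\<close>

lemma budget_next:
  assumes R: "R \<noteq> {}" and b: "budget p M K j d n R" and j: "j < 2"
  shows "budget p M K (Suc j) (if j = 0 then d else \<not> d) (Suc n)
    (rest p M (if j = 0 then d else \<not> d) R)"
proof -
  obtain k where k: "reach p M k (after p M j d R)" "2 * (n + (2 - j)) + 3 * k \<le> 3 * K"
    using R b by (auto simp: budget_def)
  have "after p M j d R =
      after p M (Suc j) (if j = 0 then d else \<not> d) (rest p M (if j = 0 then d else \<not> d) R)"
    using j by (auto simp: after_def)
  moreover have "Suc n + (2 - Suc j) = n + (2 - j)" using j by simp
  ultimately show ?thesis using k unfolding budget_def by metis
qed

text \<open>\<open>K\<close> stands for the optimum. The set passed to \<open>budget\<close> is what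
  stays unwritten once the current run is completed maximally. After \<open>First l\<close> the
  direction is tied to \<open>hd W\<close>, as in \<open>view\<close>.\<close>

definition invar :: "('a::linorder \<Rightarrow> nat) \<Rightarrow> nat \<Rightarrow> nat \<Rightarrow> 'a list \<Rightarrow> 'a list \<Rightarrow> bool" where
  "invar p M K S W \<longleftrightarrow> sorted_wrt (\<lambda>x y. p x < p y) W \<and>
    (S = [] \<and> reach p M K (set W) \<or>
     (\<exists>n j d l. j \<le> 2 \<and> splits n d l S \<and> l \<notin> set W \<and>
        budget p M K j d n (set W - mrun p M d {y. lt d l y} (set W)) \<and>
        (phase S = Run j d l \<or> phase S = First l \<and> j = 0 \<and> (W \<noteq> [] \<longrightarrow> d = (l < hd W)))))"

lemma invarI:
  assumes "sorted_wrt (\<lambda>x y. p x < p y) W" "j \<le> 2" "splits n d l S" "l \<notin> set W"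
    and "budget p M K j d n (set W - mrun p M d {y. lt d l y} (set W))"
    and "phase S = Run j d l \<or> phase S = First l \<and> j = 0 \<and> (W \<noteq> [] \<longrightarrow> d = (l < hd W))"
  shows "invar p M K S W"
  using assms unfolding invar_def by blast

text \<open>Writing the greedy choice does not change what the run will finally leave, so
  \<open>budget\<close> carries over. \<open>Q = UNIV\<close> is the start of a run,
  \<open>Q = {y. lt d l y}\<close> its continuation.\<close>

lemma rest_step:
  assumes W: "sorted_wrt (\<lambda>x y. p x < p y) W" and Q: "\<And>x y. x \<in> Q \<Longrightarrow> lt d x y \<Longrightarrow> y \<in> Q"
    and ne: "{x \<in> set (take M W). x \<in> Q} \<noteq> {}"
    and c: "c = least d {x \<in> set (take M W). x \<in> Q}"
  shows "set W - mrun p M d Q (set W) =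
    set (filter (\<lambda>y. y \<noteq> c) W) - mrun p M d {y. lt d c y} (set (filter (\<lambda>y. y \<noteq> c) W))"
proof -
  let ?C = "{x \<in> set (take M W). x \<in> Q}"
  have fin: "finite ?C" by simp
  have C: "?C = {x \<in> set W. rk p (set W) x < M \<and> x \<in> Q}" by (auto simp: set_take_eq[OF W])
  have cC: "c \<in> ?C" unfolding c by (rule least_in[OF fin ne])
  have "mrun p M d Q (set W) = insert c (mrun p M d {y. lt d c y} (set W - {c}))"
  proof (rule mrun_step)
    show "lt d c x" if "x \<in> set W" "x \<in> Q" "rk p (set W) x < M" "x \<noteq> c" for x
      using lt_least[OF fin, of x d] that unfolding c C by auto
  qed (use Q cC C in auto)
  moreover have "set (filter (\<lambda>y. y \<noteq> c) W) = set W - {c}" by auto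
  ultimately show ?thesis by auto
qed

lemma new_round:
  assumes W: "sorted_wrt (\<lambda>x y. p x < p y) W" "W \<noteq> []" and M: "M \<ge> 2"
    and k: "reach p M k (set W)" "2 * n + 3 * k \<le> 3 * K"
    and d: "d = decide M (take (4 * M) W)" and c: "c = least d (set (take M W))"
    and S: "splits (Suc n) d c (S @ [c])" "phase (S @ [c]) = First c"
  shows "invar p M K (S @ [c]) (filter (\<lambda>y. y \<noteq> c) W)"
proof -
  let ?W = "filter (\<lambda>y. y \<noteq> c) W"
  have M0: "M > 0" using M by simp
  have "budget p M K 0 d (Suc n) (rest p M d (set W))"
    using W by (intro budget_round[OF _ _ k] decide_longer[OF _ M0 d]) auto
  moreover have "rest p M d (set W) = set ?W - mrun p M d {y. lt d c y} (set ?W)"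
    using W M by (intro rest_step) (auto simp: c)
  ultimately have b: "budget p M K 0 d (Suc n) (set ?W - mrun p M d {y. lt d c y} (set ?W))"
    by (simp only:)
  \<comment> \<open>As \<open>M \<ge> 2\<close>, the oldest element other than \<open>c\<close> was
    in the buffer from which \<open>c\<close> was chosen as least, so it lies beyond
    \<open>c\<close> and reveals \<open>d\<close>.\<close>
  have hd: "d = (c < hd ?W)" if ne: "?W \<noteq> []"
  proof -
    obtain a W' where a: "W = a # W'" using W(2) by (cases W) auto
    have "hd ?W \<in> set (take 2 W)"
    proof (cases "a = c")
      case True
      then have "W' \<noteq> []" "c \<notin> set W'"
        using ne a sorted_wrt_distinct[OF W(1)] by auto
      then show ?thesis using True a by (cases W') auto
    qed (simp add: a)
    then have "hd ?W \<in> set (take M W)" using set_take_subset_set_take[OF M, of W] by blast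
    moreover have "hd ?W \<noteq> c" using hd_in_set[OF ne] by auto
    ultimately have "lt d c (hd ?W)"
      using lt_least[OF finite_set, of "hd ?W" "take M W" d] unfolding c[symmetric] by blast
    then show ?thesis by (cases d) (auto simp: lt_def)
  qed
  show ?thesis
    by (rule invarI[OF _ _ S(1) _ b]) (use S(2) W(1) hd in \<open>auto intro: sorted_wrt_filter\<close>)
qed

lemma invar_step:
  assumes inv: "invar p M K S W" and M: "M \<ge> 2" and ne: "W \<noteq> []"
    and c: "c = alg M S (take (4 * M) W)"
  shows "invar p M K (S @ [c]) (filter (\<lambda>y. y \<noteq> c) W)"
proof -
  let ?V = "take (4 * M) W" and ?W = "filter (\<lambda>y. y \<noteq> c) W"
  let ?d = "decide M ?V"
  have W: "sorted_wrt (\<lambda>x y. p x < p y) W" using inv by (simp add: invar_def)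
  have nin: "c \<notin> set ?W" by simp
  have W': "sorted_wrt (\<lambda>x y. p x < p y) ?W" using W by (rule sorted_wrt_filter)
  have take: "take M ?V = take M W" by (simp add: min_def)
  have hd: "hd ?V = hd W" using M ne by (cases W) (auto simp: take_Cons')
  have neB: "set (take M W) \<noteq> {}" using M ne by simp
  consider "S = []" "reach p M K (set W)" |
    n j d l where "j \<le> 2" "splits n d l S" "l \<notin> set W"
      "budget p M K j d n (set W - mrun p M d {y. lt d l y} (set W))"
      "phase S = Run j d l \<or> phase S = First l \<and> j = 0 \<and> d = (l < hd W)"
    using inv ne unfolding invar_def by blast
  then show ?thesis
  proof cases
    case 1
    then have cd: "c = least ?d (set (take M W))" using c take by (simp add: alg_def view_def)
    have "splits (Suc 0) ?d c (S @ [c])" "phase (S @ [c]) = First c"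
      using 1(1) splits_first by (simp_all add: phase_def)
    then show ?thesis using 1(2) by (intro new_round[OF W ne M 1(2) _ refl cd]) auto
  next
    case 2
    define C where "C = {y \<in> set (take M W). lt d l y}"
    have v: "view S ?V = Run j d l" using 2(5) hd by (auto simp: view_def)
    have ch: "c = (if C \<noteq> {} then least d C
      else if j = 0 then least d (set (take M W))
      else if j = 1 then least (\<not> d) (set (take M W))
      else least ?d (set (take M W)))"
      unfolding c alg_def v by (simp only: select.simps Let_def take C_def)
    show ?thesis
    proof (cases "C = {}")
      case False
      then have cC: "c = least d C" using ch by simp
      have "c \<in> C" unfolding cC by (rule least_in[OF _ False]) (simp add: C_def)
      then have lc: "lt d l c" by (simp add: C_def)
      have "set W - mrun p M d {y. lt d l y} (set W) = set ?W - mrun p M d {y. lt d c y} (set ?W)"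
      proof (rule rest_step[OF W])
        show "y \<in> {y. lt d l y}" if "x \<in> {y. lt d l y}" "lt d x y" for x y
          using that lt_trans by blast
      qed (use False cC in \<open>auto simp: C_def\<close>)
      then have "budget p M K j d n (set ?W - mrun p M d {y. lt d c y} (set ?W))"
        using 2(4) by (simp only:)
      moreover have "phase (S @ [c]) = Run j d c" using 2(5) lc by (auto simp: lt_def)
      ultimately show ?thesis
        by (intro invarI[OF W' 2(1) splits_extend[OF 2(2) lc] nin]) auto
    next
      case True
      \<comment> \<open>No buffer element continues the run, so it is complete and all of
        \<open>set W\<close> remains after it.\<close>
      have "mrun p M d {y. lt d l y} (set W) = {}"
        using True by (intro mrun_empty) (auto simp: C_def set_take_eq[OF W])
      then have b: "budget p M K j d n (set W)" using 2(4) by simp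
      \<comment> \<open>After \<open>First l\<close>, the element \<open>hd W\<close> is in the
        buffer and beyond \<open>l\<close>, so the first run of a round cannot end here before its
        direction shows in the output.\<close>
      have ph: "phase S = Run j d l"
      proof (rule ccontr)
        assume "phase S \<noteq> Run j d l"
        then have f: "d = (l < hd W)" using 2(5) by auto
        have "hd W \<in> set (take M W)" using M ne by (cases W) (auto simp: take_Cons')
        then have "\<not> lt d l (hd W)" using True by (auto simp: C_def)
        then have "hd W = l" using f by (auto simp: lt_def split: if_splits)
        then show False using 2(3) hd_in_set[OF ne] by simp
      qed
      show ?thesis
      proof (cases "j < 2")
        case j: True
        define e where "e = (if j = 0 then d else \<not> d)"
        have ce: "c = least e (set (take M W))" using ch True j by (auto simp: e_def)
        have "c \<in> set (take M W)" unfolding ce by (rule least_in[OF finite_set neB])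
        then have "\<not> lt d l c" using True by (auto simp: C_def)
        then have ph': "phase (S @ [c]) = Run (Suc j) e c"
          using ph j by (cases "j = 0") (auto simp: e_def)
        have "rest p M e (set W) = set ?W - mrun p M e {y. lt e c y} (set ?W)"
          by (rule rest_step[OF W]) (use neB ce in auto)
        moreover have "budget p M K (Suc j) e (Suc n) (rest p M e (set W))"
          unfolding e_def by (rule budget_next[OF _ b j]) (simp add: ne)
        ultimately have "budget p M K (Suc j) e (Suc n) (set ?W - mrun p M e {y. lt e c y} (set ?W))"
          by (simp only:)
        then show ?thesis
          using ph' j by (intro invarI[OF W' _ splits_new[OF 2(2)] nin]) auto
      next
        case False
        then have j: "j = 2" using 2(1) by simp
        have ce: "c = least ?d (set (take M W))" using ch True j by simp
        have "c \<in> set (take M W)" unfolding ce by (rule least_in[OF finite_set neB])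
        then have "\<not> lt d l c" using True by (auto simp: C_def)
        then have ph': "phase (S @ [c]) = First c" using ph j by simp
        \<comment> \<open>For \<open>j = 2\<close> the round ends with the current run, so
          \<open>budget\<close> directly supplies what \<open>new_round\<close> assumes.\<close>
        obtain k where "reach p M k (set W)" "2 * n + 3 * k \<le> 3 * K"
          using b j ne by (auto simp: budget_def after_def)
        then show ?thesis
          by (rule new_round[OF W ne M _ _ refl ce splits_new[OF 2(2)] ph'])
      qed
    qed
  qed
qed

section \<open>Lower bound and competitive ratio\<close>

text \<open>If the dropped first element \<open>y\<close> arrived before \<open>x\<close>, rank and
  index of \<open>x\<close> both fall by one; otherwise \<open>x\<close> ranks no higher than
  \<open>y\<close>, which came from the initial buffer.\<close>

lemma rk_bound_drop:
  assumes "distinct (r @ S)" "\<forall>i<length (r @ S). rk p (set (r @ S)) ((r @ S) ! i) < M + i"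
  shows "\<forall>i<length S. rk p (set S) (S ! i) < M + i"
  using assms
proof (induction r)
  case (Cons y r)
  let ?T = "r @ S"
  have "rk p (set ?T) (?T ! i) < M + i" if i: "i < length ?T" for i
  proof -
    let ?x = "?T ! i"
    have eq: "rk p (insert y (set ?T)) ?x = rk p (set ?T) ?x + card {a \<in> {y}. p a < p ?x}"
      using rk_Diff[of "insert y (set ?T)" "{y}" p ?x] Cons.prems(1) by simp
    have x: "rk p (insert y (set ?T)) ?x < M + Suc i" using Cons.prems(2) i by fastforce
    have y: "rk p (insert y (set ?T)) y < M" using Cons.prems(2) by fastforce
    show ?thesis
    proof (cases "p y < p ?x")
      case True
      then have "{a \<in> {y}. p a < p ?x} = {y}" by auto
      then show ?thesis using eq x by simp
    next
      case False
      then have "rk p (insert y (set ?T)) ?x \<le> rk p (insert y (set ?T)) y" by (intro rk_mono) auto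
      then show ?thesis using eq y by simp
    qed
  qed
  then show ?case using Cons by simp
qed simp

lemma is_run_sorted_wrt_lt:
  fixes r :: "'a::linorder list"
  assumes "is_run r" "distinct r"
  obtains d where "sorted_wrt (lt d) r"
proof -
  have eq: "lt True = ((<) :: 'a \<Rightarrow> 'a \<Rightarrow> bool)" "lt False = (\<lambda>x y :: 'a. y < x)"
    by (simp_all add: lt_def fun_eq_iff)
  have "sorted_wrt (lt True) r \<or> sorted_wrt (lt False) r"
    using assms strict_sorted_iff[of r] strict_sorted_iff[of "rev r"]
    unfolding eq is_run_def sorted_wrt_rev[of "(<)", symmetric] by auto
  then show ?thesis using that by blast
qed

text \<open>In the first run, the element at index \<open>i\<close> has the \<open>i\<close>
  elements written before it as predecessors in direction \<open>d\<close>, so the run is feasible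
  and lies inside the maximal one. What the latter leaves is contained in the later runs, and
  \<open>reach_mono\<close> applies.\<close>

lemma reach_runs:
  assumes "distinct (concat rs)" "\<forall>r\<in>set rs. is_run r"
    "\<forall>i<length (concat rs). rk p (set (concat rs)) (concat rs ! i) < M + i"
  shows "reach p M (length rs) (set (concat rs))"
  using assms
proof (induction rs)
  case (Cons r rs)
  let ?S = "concat (r # rs)"
  obtain d where d: "sorted_wrt (lt d) r" using Cons.prems(1,2) is_run_sorted_wrt_lt[of r] by auto
  have "feas p M d (set ?S) (set r)"
    unfolding feas_def
  proof (intro conjI ballI)
    fix x assume "x \<in> set r"
    then obtain i where i: "i < length r" "x = r ! i" by (metis in_set_conv_nth)
    have "set (take i r) \<subseteq> {y \<in> set r. lt d y x}"
    proof
      fix y assume "y \<in> set (take i r)"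
      then obtain k where "k < i" "y = r ! k" by (auto simp: set_take_conv)
      then show "y \<in> {y \<in> set r. lt d y x}" using d i by (simp add: sorted_wrt_iff_nth_less)
    qed
    then have "card (set (take i r)) \<le> card {y \<in> set r. lt d y x}" by (intro card_mono) auto
    moreover have "card (set (take i r)) = i" using Cons.prems(1) i by (simp add: distinct_card)
    moreover have "rk p (set ?S) (?S ! i) < M + i" by (rule Cons.prems(3)[rule_format]) (use i in simp)
    ultimately show "rk p (set ?S) x < M + card {y \<in> set r. lt d y x}"
      using i by (simp add: nth_append)
  qed auto
  then have "set r \<subseteq> mrun p M d UNIV (set ?S)" by (rule feas_subset_mrun) simp
  then have "rest p M d (set ?S) \<subseteq> set (concat rs)" by auto
  moreover have "reach p M (length rs) (set (concat rs))"
  proof (rule Cons.IH)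
    show "\<forall>i<length (concat rs). rk p (set (concat rs)) (concat rs ! i) < M + i"
      using Cons.prems(1,3) unfolding concat.simps by (rule rk_bound_drop)
  qed (use Cons.prems(1,2) in auto)
  ultimately have "reach p M (length rs) (rest p M d (set ?S))"
    by (rule reach_mono[OF finite_set])
  then show ?case by auto
qed simp

lemma num_runs_attained:
  obtains rs where "length rs = num_runs S" "concat rs = S" "\<forall>r\<in>set rs. is_run r"
proof -
  have "\<exists>k rs. length rs = k \<and> concat rs = S \<and> (\<forall>r\<in>set rs. is_run r)"
    by (intro exI[of _ "map (\<lambda>x. [x]) S"] exI[of _ "length S"]) (auto simp: is_run_def)
  then have "\<exists>rs. length rs = num_runs S \<and> concat rs = S \<and> (\<forall>r\<in>set rs. is_run r)"
    unfolding num_runs_def by (rule LeastI_ex)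
  then show ?thesis using that by blast
qed

lemma remove1_eq_filter: "distinct xs \<Longrightarrow> remove1 x xs = filter (\<lambda>y. y \<noteq> x) xs"
  unfolding distinct_remove1_removeAll removeAll_filter_not_eq by (rule filter_cong) auto

lemma write_elem_eq:
  assumes "x \<in> set B" "distinct (B @ U)"
  obtains B' U' where "write_elem x (S, B, U) = (S @ [x], B', U')"
    "B' @ U' = filter (\<lambda>y. y \<noteq> x) (B @ U)" "length B' = length B - 1 + min 1 (length U)"
proof -
  have "remove1 x B @ U = remove1 x (B @ U)" using assms by (simp add: remove1_append)
  also have "\<dots> = filter (\<lambda>y. y \<noteq> x) (B @ U)"
    by (rule remove1_eq_filter[OF assms(2)])
  finally have "(remove1 x B @ take 1 U) @ drop 1 U = filter (\<lambda>y. y \<noteq> x) (B @ U)"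
    by (metis append_assoc append_take_drop_id)
  moreover have "length (remove1 x B @ take 1 U) = length B - 1 + min 1 (length U)"
    using assms by (simp add: length_remove1)
  ultimately show ?thesis using that by (metis write_elem.simps)
qed

text \<open>When \<open>x\<close> is written, everything that arrived earlier has been read, so it
  is either written already or among the at most \<open>M - 1\<close> other elements of the
  buffer.\<close>

lemma achievable_rk:
  assumes ach: "achievable M I S" and p: "sorted_wrt (\<lambda>x y. p x < p y) I"
  shows "distinct S \<and> set S = set I \<and> (\<forall>i<length S. rk p (set I) (S ! i) < M + i)"
proof -
  define P where "P = (\<lambda>(S, B, U). distinct S \<and> set S \<union> set (B @ U) = set I \<and>
    set S \<inter> set (B @ U) = {} \<and> sorted_wrt (\<lambda>x y. p x < p y) (B @ U) \<and> length B \<le> M \<and>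
    (\<forall>i<length S. rk p (set I) (S ! i) < M + i))"
  have "step\<^sup>*\<^sup>* (init_config M I) (S, [], [])" using ach by (simp add: achievable_def)
  then have "P (S, [], [])"
  proof (induction rule: rtranclp_induct)
    case base
    show ?case using p by (simp add: P_def init_config_def set_append[symmetric] del: set_append)
  next
    case (step c c')
    from step.hyps(2) obtain x S B U
      where c: "c = (S, B, U)" "c' = write_elem x (S, B, U)" and x: "x \<in> set B"
      by (auto elim: step.cases)
    have inv: "distinct S" "set S \<union> set (B @ U) = set I" "set S \<inter> set (B @ U) = {}"
      "sorted_wrt (\<lambda>x y. p x < p y) (B @ U)" "length B \<le> M"
      "\<forall>i<length S. rk p (set I) (S ! i) < M + i"
      using step.IH by (auto simp: P_def c)
    obtain B' U' where eq: "write_elem x (S, B, U) = (S @ [x], B', U')"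
      "B' @ U' = filter (\<lambda>y. y \<noteq> x) (B @ U)" "length B' = length B - 1 + min 1 (length U)"
      using write_elem_eq[OF x sorted_wrt_distinct[OF inv(4)]] by metis
    have "{y \<in> set I. p y < p x} \<subseteq> set S \<union> (set B - {x})"
      using inv(2,4) x by (fastforce simp: sorted_wrt_append)
    then have "rk p (set I) x \<le> card (set S \<union> (set B - {x}))"
      unfolding rk_def by (intro card_mono) auto
    also have "\<dots> \<le> card (set S) + card (set B - {x})" by (rule card_Un_le)
    also have "\<dots> < length S + length B"
    proof -
      have "card (set B - {x}) < card (set B)" using x by (intro psubset_card_mono) auto
      then show ?thesis using card_length[of S] card_length[of B] by linarith
    qed
    finally have rk: "rk p (set I) x < M + length S" using inv(5) by simp
    have "length B' \<le> M" using eq(3) inv(5) x by (cases B) auto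
    moreover have "sorted_wrt (\<lambda>x y. p x < p y) (B' @ U')"
      unfolding eq(2) using inv(4) by (rule sorted_wrt_filter)
    moreover have "distinct (S @ [x])" using inv(1,3) x by auto
    moreover have "set (B' @ U') = set (B @ U) - {x}" unfolding eq(2) by auto
    then have "set (S @ [x]) \<union> set (B' @ U') = set I" "set (S @ [x]) \<inter> set (B' @ U') = {}"
      using inv(2,3) x by auto
    moreover have "\<forall>i<length (S @ [x]). rk p (set I) ((S @ [x]) ! i) < M + i"
      using inv(6) rk by (auto simp: nth_append less_Suc_eq)
    ultimately show ?case unfolding c(2) eq(1) P_def by blast
  qed
  then show ?thesis by (simp add: P_def)
qed

lemma reach_OPT:
  assumes "M > 0" and p: "sorted_wrt (\<lambda>x y. p x < p y) I"
  shows "reach p M (OPT M I) (set I)"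
proof -
  obtain S where S: "achievable M I S" "num_runs S = OPT M I"
    using OPT_attained[OF assms(1)] by blast
  obtain rs where "length rs = OPT M I" "concat rs = S" "\<forall>r\<in>set rs. is_run r"
    using num_runs_attained[of S] S(2) by auto
  then show ?thesis using reach_runs[of rs p M] achievable_rk[OF S(1) p] by auto
qed

lemma invar_online:
  assumes M: "M \<ge> 2" and p: "sorted_wrt (\<lambda>x y. p x < p y) I" and n: "n \<le> length I"
  shows "\<exists>S B U. (online_step (4 * M) (alg M) ^^ n) (init_config M I) = (S, B, U) \<and>
    invar p M (OPT M I) S (B @ U) \<and> length (B @ U) = length I - n \<and>
    length B = min M (length I - n)"
  using n
proof (induction n)
  case 0
  have "invar p M (OPT M I) [] I" using reach_OPT[OF _ p] M p by (simp add: invar_def)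
  then show ?case by (auto simp: init_config_def min_def)
next
  case (Suc n)
  then obtain S B U where eq: "(online_step (4 * M) (alg M) ^^ n) (init_config M I) = (S, B, U)"
    and inv: "invar p M (OPT M I) S (B @ U)"
    and len: "length (B @ U) = length I - n" "length B = min M (length I - n)"
    by auto
  define x where "x = alg M S (take (4 * M) (B @ U))"
  have ne: "B @ U \<noteq> []" using len Suc.prems by auto
  have "x \<in> set (take M (take (4 * M) (B @ U)))"
    unfolding x_def alg_def using M ne by (intro select_in) auto
  also have "take M (take (4 * M) (B @ U)) = B" using len M by (auto simp: min_def split: if_splits)
  finally have x: "x \<in> set B" .
  have dist: "distinct (B @ U)" using inv sorted_wrt_distinct unfolding invar_def by blast
  obtain B' U' where w: "write_elem x (S, B, U) = (S @ [x], B', U')"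
    "B' @ U' = filter (\<lambda>y. y \<noteq> x) (B @ U)" "length B' = length B - 1 + min 1 (length U)"
    using write_elem_eq[OF x dist] by metis
  have "invar p M (OPT M I) (S @ [x]) (B' @ U')"
    unfolding w(2) by (rule invar_step[OF inv M ne x_def])
  moreover have "(online_step (4 * M) (alg M) ^^ Suc n) (init_config M I) = (S @ [x], B', U')"
    using eq w(1) by (simp add: x_def)
  moreover have "filter (\<lambda>y. y \<noteq> x) (B @ U) = remove1 x (B @ U)"
    by (rule remove1_eq_filter[OF dist, symmetric])
  then have "length (B' @ U') = length I - Suc n" using w(2) len x by (simp add: length_remove1)
  moreover have "length B' = min M (length I - Suc n)"
    using w(3) len x Suc.prems by (cases B) (auto simp: min_def split: if_splits)
  ultimately show ?case by blast
qed

text \<open>With nothing left to write, either alternative of \<open>budget\<close> gives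
  \<open>2 * n \<le> 3 * K\<close>.\<close>

lemma invar_final:
  assumes "invar p M K S []"
  shows "2 * num_runs S \<le> 3 * K"
proof (cases "S = []")
  case True
  have "num_runs S = 0" unfolding num_runs_def using True by (intro Least_eq_0) auto
  then show ?thesis by simp
next
  case False
  then obtain n j d l where "splits n d l S" "budget p M K j d n {}"
    using assms by (auto simp: invar_def)
  then show ?thesis using splits_num_runs[of n d l S] by (auto simp: budget_def)
qed

text \<open>A single slot forces the output. This settles \<open>M = 1\<close>, where the buffer has
  no second element to reveal a direction.\<close>

lemma achievable_one:
  assumes "achievable 1 I S"
  shows "S = I"
proof -
  have "step\<^sup>*\<^sup>* (init_config 1 I) (S, [], [])" using assms by (simp add: achievable_def)
  then have "case (S, [], []) of (S, B, U) \<Rightarrow> S @ B @ U = I \<and> length B \<le> 1"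
  proof (induction rule: rtranclp_induct)
    case base
    show ?case by (simp add: init_config_def)
  next
    case (step c c')
    from step.hyps(2) obtain x S B U
      where c: "c = (S, B, U)" "c' = write_elem x (S, B, U)" "x \<in> set B"
      by (auto elim: step.cases)
    then have "B = [x]" using step.IH by (cases B) auto
    then show ?case using c step.IH by (cases U) auto
  qed
  then show ?thesis by simp
qed

theorem theorem8:
  fixes M :: nat
  assumes "M > 0"
  shows "\<exists>A :: 'a::linorder algorithm. online_algorithm M (4 * M) A \<and>
    (\<forall>I :: 'a list. distinct I \<longrightarrow>
      real (num_runs (online_output M (4 * M) A I)) \<le> 3 / 2 * real (OPT M I))"
proof (intro exI conjI allI impI)
  show "online_algorithm M (4 * M) (alg M :: 'a algorithm)"
    using assms by (rule online_algorithm_alg)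
  fix I :: "'a list" assume dist: "distinct I"
  show "real (num_runs (online_output M (4 * M) (alg M) I)) \<le> 3 / 2 * real (OPT M I)"
  proof (cases "M = 1")
    case True
    have "online_output M (4 * M) (alg M) I = I"
      using achievable_online_output[OF online_algorithm_alg[OF assms] assms] achievable_one True
      by blast
    moreover have "num_runs I = OPT M I" using OPT_attained[OF assms, of I] achievable_one True by blast
    ultimately show ?thesis by simp
  next
    case False
    then have M: "M \<ge> 2" using assms by simp
    obtain S B U where "(online_step (4 * M) (alg M) ^^ length I) (init_config M I) = (S, B, U)"
      "invar (pos I) M (OPT M I) S (B @ U)" "length (B @ U) = 0"
      using invar_online[OF M sorted_wrt_pos[OF dist] order.refl] by auto
    then have "2 * num_runs (online_output M (4 * M) (alg M) I) \<le> 3 * OPT M I"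
      using invar_final[of "pos I" M "OPT M I" S] by (simp add: online_output_def)
    then show ?thesis by linarith
  qed
qed

end
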